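(* Let $m\ge 3$ be an integer. There exist finite sets $A$ and $B$ of integers and an increasing sequence of positive integers $h_1<h_2<\cdots<h_m$ such that $|A|=|B|$, $\operatorname{diam}(A)=\operatorname{diam}(B)$, and for every $i\in\{1,\dots,m\}$, $$|h_i A|>|h_i B| \quad\text{if } i \text{ is odd},$$ and $$|h_i A|<|h_i B| \quad\text{if } i \text{ is even}.$$
   Context: For a nonempty set $A$ of integers and a positive integer $h$, the $h$-fold sumset of $A$ is $hA=\{a_1+\cdots+a_h : a_i\in A \text{ for all } 1\le i\le h\}$ (sums of $h$ not necessarily distinct elements of $A$). $|X|$ denotes the number of elements of a finite set $X$. For a finite nonempty set $A$ of integers, $\operatorname{diam}(A)=\max(A)-\min(A)$. *)

theory Defs
  imports Complex_Main
begin

definition sumset :: "nat \<Rightarrow> int set \<Rightarrow> int set" where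
  "sumset h A = {\<Sum>i=1..h. a i | a. \<forall>i\<in>{1..h}. a i \<in> A}"

text \<open>Intended for finite nonempty sets only; otherwise \<open>Max\<close> and \<open>Min\<close> are unspecified.\<close>

definition diam :: "int set \<Rightarrow> int" where
  "diam A = Max A - Min A"

end

theory Submission
  imports Defs
begin

text \<open>
  The set \<open>{x + N y | x \<in> A, y \<in> C}\<close> with \<open>N\<close> large has \<open>h\<close>-fold sumset of size \<open>|hA| |hC|\<close>
  for all \<open>h\<close> up to a given bound, so pairs of sets can be combined by multiplying sumset sizes.
  For \<open>n \<ge> 2\<close> the pair \<open>P = {0, 1, 2n-1, 2n}\<close>, \<open>Q = {0, 1, 2, 2n}\<close> satisfies
  \<open>|hP| = |hQ| = (h+1)\<^sup>2\<close> for \<open>h < n\<close>, while \<open>|nP| = (n+1)\<^sup>2 > |nQ|\<close>.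
  Multiplying a given pair by a high power of \<open>(P, Q)\<close>, or of \<open>(Q, P)\<close>, thus keeps every comparison
  at \<open>h < n\<close> and prescribes the one at \<open>h = n\<close>. Doing this for \<open>n = 2, 3, \<dots>\<close> in turn yields any
  pattern of strict comparisons at \<open>h = 2, 3, \<dots>, m + 1\<close>.
\<close>

section \<open>Iterated sumsets\<close>

lemma sumset_0 [simp]: "sumset 0 A = {0}"
  by (auto simp: sumset_def)

text \<open>Splitting off the last summand turns the indexed definition into a recursion, on which
  the later inductions on \<open>h\<close> rest.\<close>

lemma sumset_Suc: "sumset (Suc h) A = {x + a | x a. x \<in> sumset h A \<and> a \<in> A}"
proof (intro subset_antisym subsetI)
  fix z assume "z \<in> sumset (Suc h) A"
  then obtain a where a: "\<forall>i\<in>{1..Suc h}. a i \<in> A" "z = (\<Sum>i=1..Suc h. a i)"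
    by (auto simp: sumset_def)
  then have "(\<Sum>i=1..h. a i) \<in> sumset h A" "a (Suc h) \<in> A"
    by (auto simp: sumset_def)
  then show "z \<in> {x + a | x a. x \<in> sumset h A \<and> a \<in> A}"
    using a(2) by auto
next
  fix z assume "z \<in> {x + a | x a. x \<in> sumset h A \<and> a \<in> A}"
  then obtain a b where a: "\<forall>i\<in>{1..h}. a i \<in> A" "b \<in> A" "z = (\<Sum>i=1..h. a i) + b"
    by (auto simp: sumset_def)
  define c where "c = a(Suc h := b)"
  have "(\<Sum>i=1..h. c i) = (\<Sum>i=1..h. a i)"
    by (intro sum.cong) (auto simp: c_def)
  then have "z = (\<Sum>i=1..Suc h. c i)"
    using a by (simp add: c_def)
  moreover have "\<forall>i\<in>{1..Suc h}. c i \<in> A"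
    using a by (auto simp: c_def)
  ultimately show "z \<in> sumset (Suc h) A"
    unfolding sumset_def by blast
qed

lemma sumset_1 [simp]: "sumset (Suc 0) A = A"
  by (auto simp: sumset_Suc)

lemma finite_sumset: "finite A \<Longrightarrow> finite (sumset h A)"
  by (induction h) (auto simp: sumset_Suc intro: finite_image_set2)

lemma sumset_nonempty: "A \<noteq> {} \<Longrightarrow> sumset h A \<noteq> {}"
  by (induction h) (auto simp: sumset_Suc)

lemma sumset_zero: "sumset h {0} = {0}"
  by (induction h) (auto simp: sumset_Suc)

lemma sumset_zero_one: "sumset h {0, 1} = {0..int h}"
proof (induction h)
  case (Suc h)
  have "{x + a | x a. x \<in> {0..int h} \<and> a \<in> {0, 1}} = {0..int (Suc h)}"
  proof (intro subset_antisym subsetI)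
    fix z assume z: "z \<in> {0..int (Suc h)}"
    show "z \<in> {x + a | x a. x \<in> {0..int h} \<and> a \<in> {0, 1::int}}"
    proof (cases "z = 0")
      case True
      then show ?thesis by force
    next
      case False
      then have "z = (z - 1) + 1" "z - 1 \<in> {0..int h}" using z by auto
      then show ?thesis by blast
    qed
  qed auto
  then show ?case by (simp only: sumset_Suc Suc)
qed simp

text \<open>Two-digit numbers in base \<open>N\<close>, with low digits from \<open>A\<close> and
  high digits from \<open>C\<close>. Uniqueness of the digits is not built in; it comes from a bound
  on the spread of \<open>A\<close>.\<close>

definition radix :: "int \<Rightarrow> int set \<Rightarrow> int set \<Rightarrow> int set" where
  "radix N A C = (\<lambda>(x, y). x + N * y) ` (A \<times> C)"

text \<open>The map sending \<open>(x, y)\<close> to \<open>x + N * y\<close> is additive, so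
  summands can be regrouped digit by digit.\<close>

lemma sumset_radix: "sumset h (radix N A C) = radix N (sumset h A) (sumset h C)"
proof (induction h)
  case 0
  then show ?case by (simp add: radix_def)
next
  case (Suc h)
  show ?case
  proof (intro subset_antisym subsetI)
    fix z assume "z \<in> sumset (Suc h) (radix N A C)"
    then obtain x y a c where xy: "x \<in> sumset h A" "y \<in> sumset h C" "a \<in> A" "c \<in> C"
      and z: "z = (x + N * y) + (a + N * c)"
      unfolding sumset_Suc Suc by (auto simp: radix_def)
    have "z = (x + a) + N * (y + c)" using z by (simp add: algebra_simps)
    moreover have "x + a \<in> sumset (Suc h) A" "y + c \<in> sumset (Suc h) C"
      using xy by (auto simp: sumset_Suc)
    ultimately show "z \<in> radix N (sumset (Suc h) A) (sumset (Suc h) C)"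
      unfolding radix_def by auto
  next
    fix z assume "z \<in> radix N (sumset (Suc h) A) (sumset (Suc h) C)"
    then obtain x y a c where xy: "x \<in> sumset h A" "y \<in> sumset h C" "a \<in> A" "c \<in> C"
      and z: "z = (x + a) + N * (y + c)"
      unfolding sumset_Suc radix_def by auto
    have "z = (x + N * y) + (a + N * c)" using z by (simp add: algebra_simps)
    moreover have "x + N * y \<in> sumset h (radix N A C)" "a + N * c \<in> radix N A C"
      unfolding Suc using xy by (auto simp: radix_def)
    ultimately show "z \<in> sumset (Suc h) (radix N A C)"
      unfolding sumset_Suc by blast
  qed
qed

text \<open>If two digit pairs give the same number, their low digits differ by a multiple of
  \<open>N\<close> that is smaller than \<open>N\<close> in absolute value, hence by 0.\<close>

lemma card_radix:
  assumes "\<And>x x'. x \<in> A \<Longrightarrow> x' \<in> A \<Longrightarrow> \<bar>x - x'\<bar> < N"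
  shows "card (radix N A C) = card A * card C"
proof -
  have "inj_on (\<lambda>(x, y). x + N * y) (A \<times> C)"
  proof (rule inj_onI, clarify)
    fix x y x' y' assume xy: "x \<in> A" "x' \<in> A" "x + N * y = x' + N * y'"
    have "x - x' = N * (y' - y)" using xy by (simp add: algebra_simps)
    moreover have "\<bar>x - x'\<bar> < N" using assms xy by blast
    ultimately have "x - x' = 0" using dvd_imp_le_int[of "x - x'" N] by force
    with xy \<open>\<bar>x - x'\<bar> < N\<close> show "x = x' \<and> y = y'" by auto
  qed
  then show ?thesis by (simp add: radix_def card_image card_cartesian_product)
qed

lemma diam_radix:
  assumes "finite A" "A \<noteq> {}" "finite C" "C \<noteq> {}" "N \<ge> 0"
  shows "diam (radix N A C) = diam A + N * diam C"
proof -
  have "Max (radix N A C) = Max A + N * Max C"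
    using assms by (intro Max_eqI)
      (auto simp: radix_def intro!: add_mono mult_left_mono Max_in image_eqI[of _ _ "(Max A, Max C)"])
  moreover have "Min (radix N A C) = Min A + N * Min C"
    using assms by (intro Min_eqI)
      (auto simp: radix_def intro!: add_mono mult_left_mono Min_in image_eqI[of _ _ "(Min A, Min C)"])
  ultimately show ?thesis by (simp add: diam_def algebra_simps)
qed

section \<open>Realizable pairs of sumset sizes\<close>

text \<open>The bound \<open>H\<close> makes products possible: a base \<open>N\<close> can exceed
  the spread of only finitely many sumsets at once.\<close>

definition realizable :: "nat \<Rightarrow> (nat \<Rightarrow> nat) \<Rightarrow> (nat \<Rightarrow> nat) \<Rightarrow> bool" where
  "realizable H f g \<longleftrightarrow> (\<exists>A B. finite A \<and> A \<noteq> {} \<and> finite B \<and> B \<noteq> {} \<and> diam A = diam B \<and>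
     (\<forall>h\<le>H. card (sumset h A) = f h \<and> card (sumset h B) = g h))"

lemma realizable_swap: "realizable H f g \<Longrightarrow> realizable H g f"
  unfolding realizable_def by metis

lemma realizable_pos:
  assumes "realizable H f g" "h \<le> H"
  shows "f h > 0" "g h > 0"
  using assms finite_sumset sumset_nonempty unfolding realizable_def
  by (metis card_gt_0_iff)+

lemma realizable_one: "realizable H (\<lambda>_. 1) (\<lambda>_. 1)"
  unfolding realizable_def by (rule exI[of _ "{0}"], rule exI[of _ "{0}"]) (simp add: sumset_zero)

text \<open>Using the same base \<open>N\<close> for both sides keeps the diameters
  \<open>diam A + N * diam C\<close> and \<open>diam B + N * diam D\<close> equal.\<close>

lemma realizable_mult:
  assumes "realizable H f g" "realizable H f' g'"
  shows "realizable H (\<lambda>h. f h * f' h) (\<lambda>h. g h * g' h)"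
proof -
  obtain A B where AB: "finite A" "A \<noteq> {}" "finite B" "B \<noteq> {}" "diam A = diam B"
    "\<And>h. h \<le> H \<Longrightarrow> card (sumset h A) = f h" "\<And>h. h \<le> H \<Longrightarrow> card (sumset h B) = g h"
    using assms(1) unfolding realizable_def by blast
  obtain C D where CD: "finite C" "C \<noteq> {}" "finite D" "D \<noteq> {}" "diam C = diam D"
    "\<And>h. h \<le> H \<Longrightarrow> card (sumset h C) = f' h" "\<And>h. h \<le> H \<Longrightarrow> card (sumset h D) = g' h"
    using assms(2) unfolding realizable_def by blast
  \<comment> \<open>\<open>A\<close> and \<open>B\<close> supply the low digits, so \<open>N\<close>
    must exceed all differences within their sumsets for \<open>h \<le> H\<close>. Elements of
    \<open>S\<close> have absolute value at most \<open>K\<close>, so they differ by at most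
    \<open>2 * K\<close>.\<close>
  define S where "S = (\<Union>h\<le>H. sumset h A \<union> sumset h B)"
  define K where "K = Max (insert 0 (abs ` S))"
  define N where "N = 2 * K + 1"
  have "finite S" using AB finite_sumset by (simp add: S_def)
  then have K: "\<bar>x\<bar> \<le> K" if "x \<in> S" for x
    using that by (auto simp: K_def)
  have "K \<ge> 0"
    using \<open>finite S\<close> by (auto simp: K_def)
  have N: "\<bar>x - x'\<bar> < N" if "x \<in> S" "x' \<in> S" for x x'
    using K[OF that(1)] K[OF that(2)] by (simp add: N_def)
  have "card (sumset h (radix N A C)) = f h * f' h" if "h \<le> H" for h
  proof -
    have "\<bar>x - x'\<bar> < N" if "x \<in> sumset h A" "x' \<in> sumset h A" for x x'
      using that \<open>h \<le> H\<close> by (intro N) (auto simp: S_def)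
    then show ?thesis
      using that AB(6,7) CD(6,7) by (simp add: sumset_radix card_radix)
  qed
  moreover have "card (sumset h (radix N B D)) = g h * g' h" if "h \<le> H" for h
  proof -
    have "\<bar>x - x'\<bar> < N" if "x \<in> sumset h B" "x' \<in> sumset h B" for x x'
      using that \<open>h \<le> H\<close> by (intro N) (auto simp: S_def)
    then show ?thesis
      using that AB(6,7) CD(6,7) by (simp add: sumset_radix card_radix)
  qed
  moreover have "diam (radix N A C) = diam (radix N B D)"
    using AB CD \<open>K \<ge> 0\<close> by (simp add: diam_radix N_def)
  moreover have "finite (radix N A C)" "radix N A C \<noteq> {}" "finite (radix N B D)" "radix N B D \<noteq> {}"
    using AB CD by (auto simp: radix_def)
  ultimately show ?thesis unfolding realizable_def by blast
qed

lemma realizable_power: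
  assumes "realizable H f g"
  shows "realizable H (\<lambda>h. f h ^ e) (\<lambda>h. g h ^ e)"
proof (induction e)
  case 0
  then show ?case using realizable_one by simp
next
  case (Suc e)
  then show ?case using realizable_mult[OF assms Suc] by simp
qed

section \<open>A pair of four-element sets separated at a given \<open>n\<close>\<close>

text \<open>The set consists of the numbers with both digits in \<open>{0, 1}\<close> in base
  \<open>2 * n - 1\<close>. Its sumset is a grid of digits from 0 to \<open>h\<close>, without
  collisions while \<open>h\<close> is below the base.\<close>

lemma card_sumset_four:
  assumes "h < 2 * n - 1"
  shows "card (sumset h {0, 1, 2 * int n - 1, 2 * int n}) = (h + 1)\<^sup>2"
proof -
  have "{0, 1, 2 * int n - 1, 2 * int n} = radix (2 * int n - 1) {0, 1} {0, 1}"
    by (auto simp: radix_def)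
  moreover have "card (radix (2 * int n - 1) {0..int h} {0..int h}) = (h + 1)\<^sup>2"
    using assms by (subst card_radix) (auto simp: power2_eq_square nat_add_distrib)
  ultimately show ?thesis by (simp add: sumset_radix sumset_zero_one)
qed

text \<open>Here \<open>k\<close> counts the summands taken to be \<open>d\<close>; the other
  \<open>h - k\<close> summands from \<open>{0, 1, 2}\<close> produce every \<open>x\<close> up to
  \<open>2 * (h - k)\<close>.\<close>

lemma sumset_zero_one_two:
  "sumset h {0, 1, 2, d} = (\<lambda>(k, x). int x + d * int k) ` (SIGMA k:{..h}. {..2 * (h - k)})"
    (is "_ = ?T h")
proof (induction h)
  case (Suc h)
  show ?case
  proof (intro subset_antisym subsetI)
    fix z assume "z \<in> sumset (Suc h) {0, 1, 2, d}"
    then obtain k x a where kx: "k \<le> h" "x \<le> 2 * (h - k)" "a \<in> {0, 1, 2, d}"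
      "z = int x + d * int k + a"
      unfolding sumset_Suc Suc by auto
    then consider "z = int x + d * int k" | "z = int (x + 1) + d * int k"
      | "z = int (x + 2) + d * int k" | "z = int x + d * int (Suc k)"
      by (force simp: algebra_simps)
    then show "z \<in> ?T (Suc h)"
    proof cases
      case 1
      then show ?thesis using kx by (intro image_eqI[of _ _ "(k, x)"]) auto
    next
      case 2
      then show ?thesis using kx by (intro image_eqI[of _ _ "(k, x + 1)"]) auto
    next
      case 3
      then show ?thesis using kx by (intro image_eqI[of _ _ "(k, x + 2)"]) auto
    next
      case 4
      then show ?thesis using kx by (intro image_eqI[of _ _ "(Suc k, x)"]) auto
    qed
  next
    fix z assume "z \<in> ?T (Suc h)"
    then obtain k x where kx: "k \<le> Suc h" "x \<le> 2 * (Suc h - k)" "z = int x + d * int k"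
      by auto
    \<comment> \<open>Choose the summand to remove: \<open>d\<close> if all summands are
      \<open>d\<close>, otherwise the largest of 0, 1, 2 not exceeding \<open>x\<close>, which
      leaves a remainder within the smaller bound.\<close>
    have *: "\<exists>k x a. k \<le> h \<and> x \<le> 2 * (h - k) \<and> a \<in> {0, 1, 2, d} \<and> z = int x + d * int k + a"
    proof (cases "k = Suc h")
      case True
      then show ?thesis using kx
        by (intro exI[of _ h] exI[of _ 0] exI[of _ d]) (auto simp: algebra_simps)
    next
      case False
      then have k: "k \<le> h" using kx by simp
      consider "x = 0" | "x = 1" | "x \<ge> 2" by linarith
      then show ?thesis
      proof cases
        case 1
        then show ?thesis using kx k by (intro exI[of _ k] exI[of _ 0] exI[of _ 0]) auto
      next
        case 2
        then show ?thesis using kx k by (intro exI[of _ k] exI[of _ 0] exI[of _ 1]) auto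
      next
        case 3
        then show ?thesis using kx k by (intro exI[of _ k] exI[of _ "x - 2"] exI[of _ 2]) auto
      qed
    qed
    then obtain k x a where "k \<le> h" "x \<le> 2 * (h - k)" "a \<in> {0, 1, 2, d}"
      "z = (int x + d * int k) + a" by blast
    moreover from this have "int x + d * int k \<in> ?T h" by force
    ultimately show "z \<in> sumset (Suc h) {0, 1, 2, d}"
      unfolding sumset_Suc Suc by blast
  qed
qed simp

text \<open>The rows have odd lengths, and the first \<open>h + 1\<close> odd numbers sum to a
  square.\<close>

lemma card_triangle: "card (SIGMA k:{..h}. {..2 * (h - k)}) = (h + 1)\<^sup>2"
proof -
  have "card (SIGMA k:{..h}. {..2 * (h - k)}) = (\<Sum>k\<le>h. Suc (2 * (h - k)))"
    by simp
  also have "\<dots> = (\<Sum>k\<le>h. Suc (2 * k))"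
    by (rule sum.nat_diff_reindex[of "\<lambda>k. Suc (2 * k)" "Suc h", simplified lessThan_Suc_atMost, simplified])
  also have "\<dots> = (h + 1)\<^sup>2"
    by (induction h) (auto simp: power2_eq_square)
  finally show ?thesis .
qed

text \<open>Since \<open>x \<le> 2 * h < 2 * n\<close>, the pair \<open>(k, x)\<close> is recovered
  as quotient and remainder modulo \<open>2 * n\<close>.\<close>

lemma card_sumset_zero_one_two:
  assumes "h < n"
  shows "card (sumset h {0, 1, 2, 2 * int n}) = (h + 1)\<^sup>2"
proof -
  have "inj_on (\<lambda>(k, x). int x + 2 * int n * int k) (SIGMA k:{..h}. {..2 * (h - k)})"
  proof (rule inj_onI, clarsimp)
    fix k x k' x' :: nat
    assume *: "x \<le> 2 * (h - k)" "x' \<le> 2 * (h - k')"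
      and "int x + 2 * int n * int k = int x' + 2 * int n * int k'"
    then have "int (x + (2 * n) * k) = int (x' + (2 * n) * k')"
      by simp
    then have eq: "x + (2 * n) * k = x' + (2 * n) * k'"
      by (simp only: of_nat_eq_iff)
    have lt: "x < 2 * n" "x' < 2 * n" using * assms by auto
    then have "x = (x + (2 * n) * k) mod (2 * n)" by simp
    also have "\<dots> = x'" using lt by (simp add: eq)
    finally show "k = k' \<and> x = x'" using eq assms by auto
  qed
  then show ?thesis by (simp add: sumset_zero_one_two card_image card_triangle del: card_SigmaI)
qed

text \<open>The first collision: \<open>2 * n\<close> is both the sum of \<open>n\<close> twos and
  the element \<open>2 * n\<close> plus \<open>n - 1\<close> zeros.\<close>

lemma card_sumset_zero_one_two_less:
  assumes "n > 0"
  shows "card (sumset n {0, 1, 2, 2 * int n}) < (n + 1)\<^sup>2"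
proof -
  let ?f = "\<lambda>(k, x). int x + 2 * int n * int k" and ?T = "SIGMA k:{..n}. {..2 * (n - k)}"
  have "(0, 2 * n) \<in> ?T" "(1, 0) \<in> ?T" "?f (0, 2 * n) = ?f (1, 0)"
    using assms by auto
  then have "\<not> inj_on ?f ?T"
    by (metis (no_types, lifting) inj_onD prod.inject zero_neq_one)
  moreover have fin: "finite ?T" by auto
  ultimately have "card (?f ` ?T) < card ?T"
    by (metis card_image_le eq_card_imp_inj_on le_neq_implies_less)
  then show ?thesis by (simp only: sumset_zero_one_two card_triangle)
qed

lemma realizable_separated:
  assumes "n \<ge> 2"
  obtains p q where "realizable H p q" "\<And>h. h < n \<Longrightarrow> p h = q h" "p n > q n"
proof
  let ?P = "{0, 1, 2 * int n - 1, 2 * int n}" and ?Q = "{0, 1, 2, 2 * int n}"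
  have "diam ?P = diam ?Q"
    using assms by (simp add: diam_def)
  then show "realizable H (\<lambda>h. card (sumset h ?P)) (\<lambda>h. card (sumset h ?Q))"
    unfolding realizable_def by (intro exI[of _ ?P] exI[of _ ?Q]) simp
  show "card (sumset h ?P) = card (sumset h ?Q)" if "h < n" for h
    using that assms by (simp only: card_sumset_zero_one_two) (rule card_sumset_four, simp)
  show "card (sumset n ?P) > card (sumset n ?Q)"
    \<comment> \<open>The count for \<open>?P\<close> at \<open>h = n\<close> requires
      \<open>n < 2 * n - 1\<close>, which is where \<open>n \<ge> 2\<close> enters.\<close>
    using assms card_sumset_zero_one_two_less[of n] card_sumset_four[of n n] by simp
qed

section \<open>Prescribing the comparisons\<close>

text \<open>The powers of \<open>p / q > 1\<close> are unbounded and eventually exceed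
  \<open>b / a\<close>.\<close>

lemma power_dominates:
  fixes a b p q :: nat
  assumes "a > 0" "q > 0" "p > q"
  obtains e where "b * q ^ e < a * p ^ e"
proof -
  obtain e where e: "real b / real a < (real p / real q) ^ e"
    using real_arch_pow[of "real p / real q" "real b / real a"] assms by auto
  then have "real (b * q ^ e) < real (a * p ^ e)"
    using assms by (simp add: field_simps)
  then show thesis using that by (simp only: of_nat_less_iff)
qed

text \<open>The predicate \<open>s\<close> prescribes the direction at each \<open>n\<close>. The
  pattern starts at 2 because \<open>f 1 = g 1\<close>, carried along to give the two sets equal
  size, excludes a strict comparison at 1.\<close>

lemma realizable_pattern:
  "\<exists>f g. realizable H f g \<and> f 1 = g 1 \<and>
     (\<forall>n. 2 \<le> n \<and> n \<le> k \<and> n \<le> H \<longrightarrow> (if s n then f n > g n else f n < g n))"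
proof (induction k)
  case 0
  then show ?case using realizable_one by force
next
  case (Suc k)
  then obtain f g where fg: "realizable H f g" "f 1 = g 1"
    "\<And>n. 2 \<le> n \<Longrightarrow> n \<le> k \<Longrightarrow> n \<le> H \<Longrightarrow> if s n then f n > g n else f n < g n"
    by blast
  show ?case
  proof (cases "2 \<le> Suc k \<and> Suc k \<le> H")
    \<comment> \<open>The index \<open>Suc k\<close> is 1 or exceeds \<open>H\<close>, so it adds no
      condition and the old pair serves.\<close>
    case False
    have "if s n then f n > g n else f n < g n" if "2 \<le> n" "n \<le> Suc k" "n \<le> H" for n
      using that False fg(3)[of n] by (cases "n = Suc k") auto
    then show ?thesis using fg(1,2) by blast
  next
    case True
    then obtain p0 q0 where pq0: "realizable H p0 q0" "\<And>h. h < Suc k \<Longrightarrow> p0 h = q0 h"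
      "p0 (Suc k) > q0 (Suc k)"
      using realizable_separated[of "Suc k" H] by metis
    \<comment> \<open>Orient the separating pair so that its strict inequality at
      \<open>Suc k\<close> points the way \<open>s\<close> demands.\<close>
    define p where "p = (if s (Suc k) then p0 else q0)"
    define q where "q = (if s (Suc k) then q0 else p0)"
    have pq: "realizable H p q" "\<And>h. h < Suc k \<Longrightarrow> p h = q h"
      using pq0(1,2) realizable_swap by (auto simp: p_def q_def)
    \<comment> \<open>Positivity serves twice: to apply \<open>power_dominates\<close>, and to keep
      the earlier inequalities strict after multiplying by a common factor.\<close>
    have pos: "f n > 0" "g n > 0" "p n > 0" "q n > 0" if "n \<le> H" for n
      using realizable_pos fg(1) pq(1) that by blast+
    have "\<exists>e. if s (Suc k) then f (Suc k) * p (Suc k) ^ e > g (Suc k) * q (Suc k) ^ e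
               else f (Suc k) * p (Suc k) ^ e < g (Suc k) * q (Suc k) ^ e"
    proof (cases "s (Suc k)")
      case s: True
      then show ?thesis
        using power_dominates[of "f (Suc k)" "q (Suc k)" "p (Suc k)" "g (Suc k)"] pos True pq0(3)
        by (simp add: p_def q_def) metis
    next
      case s: False
      then show ?thesis
        using power_dominates[of "g (Suc k)" "p (Suc k)" "q (Suc k)" "f (Suc k)"] pos True pq0(3)
        by (simp add: p_def q_def) metis
    qed
    then obtain e where e: "if s (Suc k) then f (Suc k) * p (Suc k) ^ e > g (Suc k) * q (Suc k) ^ e
               else f (Suc k) * p (Suc k) ^ e < g (Suc k) * q (Suc k) ^ e" ..
    have "if s n then f n * p n ^ e > g n * q n ^ e else f n * p n ^ e < g n * q n ^ e"
      if "2 \<le> n" "n \<le> Suc k" "n \<le> H" for n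
    proof (cases "n = Suc k")
      case True
      then show ?thesis using e by simp
    next
      case False
      then have "p n = q n" "n \<le> k" using pq(2) that by auto
      then show ?thesis using fg(3)[of n] that pos[of n] by auto
    qed
    moreover have "realizable H (\<lambda>h. f h * p h ^ e) (\<lambda>h. g h * q h ^ e)"
      using realizable_mult[OF fg(1) realizable_power[OF pq(1)]] .
    moreover have "f 1 * p 1 ^ e = g 1 * q 1 ^ e"
      using fg(2) pq(2)[of 1] True by simp
    ultimately show ?thesis by blast
  qed
qed

theorem theorem1:
  fixes m :: nat
  assumes "m \<ge> 3"
  shows "\<exists>(A :: int set) (B :: int set) (h :: nat \<Rightarrow> nat).
           finite A \<and> A \<noteq> {} \<and> finite B \<and> B \<noteq> {} \<and>
           (\<forall>i\<in>{1..m}. h i > 0) \<and> strict_mono_on {1..m} h \<and>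
           card A = card B \<and> diam A = diam B \<and>
           (\<forall>i\<in>{1..m}.
              (odd i \<longrightarrow> card (sumset (h i) A) > card (sumset (h i) B)) \<and>
              (even i \<longrightarrow> card (sumset (h i) A) < card (sumset (h i) B)))"
proof -
  \<comment> \<open>With \<open>h i = i + 1\<close>, odd \<open>i\<close> corresponds to even
    \<open>n\<close>, hence the predicate \<open>even\<close>; the largest index is
    \<open>m + 1\<close>, hence the bound \<open>Suc m\<close>.\<close>
  obtain f g where fg: "realizable (Suc m) f g" "f 1 = g 1"
    "\<And>n. 2 \<le> n \<Longrightarrow> n \<le> Suc m \<Longrightarrow> if even n then f n > g n else f n < g n"
    using realizable_pattern[of "Suc m" "Suc m" even] by blast
  then obtain A B where AB: "finite A" "A \<noteq> {}" "finite B" "B \<noteq> {}" "diam A = diam B"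
    "\<And>h. h \<le> Suc m \<Longrightarrow> card (sumset h A) = f h" "\<And>h. h \<le> Suc m \<Longrightarrow> card (sumset h B) = g h"
    unfolding realizable_def by blast
  have "card A = card B"
    using AB(6)[of 1] AB(7)[of 1] fg(2) by simp
  moreover have "(odd i \<longrightarrow> card (sumset (Suc i) A) > card (sumset (Suc i) B)) \<and>
      (even i \<longrightarrow> card (sumset (Suc i) A) < card (sumset (Suc i) B))" if "i \<in> {1..m}" for i
    using fg(3)[of "Suc i"] AB(6,7)[of "Suc i"] that by auto
  moreover have "strict_mono_on {1..m} Suc"
    by (simp add: strict_mono_on_def)
  ultimately show ?thesis
    using AB by (intro exI[of _ A] exI[of _ B] exI[of _ Suc]) auto
qed

end
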